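(* Let $G$ be a finite simple connected undirected interval graph with at least two edges. Then $2\le \chi_{cf}(G)\le 4$.
   Context: A graph $G$ is an interval graph if there is a family $\{I_v : v\in V(G)\}$ of real intervals such that, for distinct $u,v$, $I_u\cap I_v\neq\emptyset$ if and only if $uv\in E(G)$. Let $N(v)$ be the set of vertices adjacent to $v$. For a coloring $C_G$ of $V(G)$ (not necessarily proper), a set $U\subseteq V(G)$ has a unique color if there is a color $c$ with $|\{u\in U: C_G(u)=c\}|=1$. The coloring is a conflict-free open neighborhood (CF-ON) coloring if $N(v)$ has a unique color for every $v\in V(G)$. $\chi_{cf}(G)$ denotes the minimum number of colors in a CF-ON coloring of $G$. *)

theory Defs
  imports
    "HOL-Analysis.Analysis"
    "HOL-Library.Extended_Nat"
    "Graph_Theory.Digraph_Component"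
begin

text \<open>
  A finite simple undirected graph is an instance of the locale \<^locale>\<open>graph\<close>: a finite symmetric
  digraph without loops and parallel arcs. Each undirected edge corresponds to two opposite arcs,
  so edges are counted as sets of end vertices.
\<close>

definition edges :: "('a, 'b) pre_digraph \<Rightarrow> 'a set set" where
  "edges G = {{u, v} | u v. u \<rightarrow>\<^bsub>G\<^esub> v}"

definition neighborhood :: "('a, 'b) pre_digraph \<Rightarrow> 'a \<Rightarrow> 'a set" where
  "neighborhood G v = {u. v \<rightarrow>\<^bsub>G\<^esub> u}"

definition interval_graph :: "('a, 'b) pre_digraph \<Rightarrow> bool" where
  "interval_graph G \<longleftrightarrow>
     (\<exists>I :: 'a \<Rightarrow> real set.
        (\<forall>v \<in> verts G. is_interval (I v)) \<and>
        (\<forall>u \<in> verts G. \<forall>v \<in> verts G. u \<noteq> v \<longrightarrow> (I u \<inter> I v \<noteq> {} \<longleftrightarrow> u \<rightarrow>\<^bsub>G\<^esub> v)))"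

definition has_unique_color :: "('a \<Rightarrow> 'c) \<Rightarrow> 'a set \<Rightarrow> bool" where
  "has_unique_color C U \<longleftrightarrow> (\<exists>c. card {u \<in> U. C u = c} = 1)"

definition cf_on_coloring :: "('a, 'b) pre_digraph \<Rightarrow> ('a \<Rightarrow> 'c) \<Rightarrow> bool" where
  "cf_on_coloring G C \<longleftrightarrow> (\<forall>v \<in> verts G. has_unique_color C (neighborhood G v))"

text \<open>
  The value is \<open>\<infinity>\<close> when there is no CF-ON coloring, as for a graph with an isolated vertex.
  Natural numbers suffice as colors, since \<^term>\<open>verts G\<close> is finite; the infimum of a nonempty set
  is attained.
\<close>

definition chi_cf :: "('a, 'b) pre_digraph \<Rightarrow> enat" where
  "chi_cf G = Inf {enat (card (C ` verts G)) | C :: 'a \<Rightarrow> nat. cf_on_coloring G C}"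

end

theory Submission
  imports Defs
begin

text \<open>
  With a single color every neighborhood would be a singleton, so a connected graph would have at most
  one edge. For the upper bound, order disjoint intervals from left to right, choose a leftmost vertex \<open>a\<close> and a
  rightmost vertex \<open>b\<close> (any neighbor of \<open>a\<close>, if \<open>a\<close> itself is rightmost), and color a shortest path
  from \<open>a\<close> to \<open>b\<close> periodically with \<open>0, 1, 2\<close> and all other vertices with \<open>3\<close>. An interval missing
  every interval of the path would lie to the right of all of them, so every vertex has a neighbor on
  the path. Its neighbors on the path have positions differing by at most two, as otherwise there
  would be a shortcut, so their colors are distinct.
\<close>

section \<open>Connected graphs\<close>

lemma (in graph) adj_sym:
  assumes "u \<rightarrow>\<^bsub>G\<^esub> v"
  shows "v \<rightarrow>\<^bsub>G\<^esub> u"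
  using assms sym_arcs by (auto simp: symmetric_def dest: symD)

lemma (in graph) connected_imp_rtrancl:
  assumes "Digraph_Component.connected G" "u \<in> verts G" "v \<in> verts G"
  shows "(u, v) \<in> (arcs_ends G)\<^sup>*"
proof -
  have "u \<rightarrow>\<^sup>*\<^bsub>G\<^esub> v"
    using symmetric_connected_imp_strongly_connected[OF sym_arcs assms(1)] assms(2,3)
    by (auto simp: strongly_connected_def)
  then show ?thesis
    by (rule reachable_rtranclI)
qed

text \<open>An edge provides a vertex other than \<open>v\<close>, and the first arc of a walk from
  \<open>v\<close> to it ends in a neighbor.\<close>

lemma (in graph) connected_neighbor_exists:
  assumes "Digraph_Component.connected G" "edges G \<noteq> {}" "v \<in> verts G"
  shows "\<exists>w. v \<rightarrow>\<^bsub>G\<^esub> w"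
proof -
  obtain x y where xy: "x \<rightarrow>\<^bsub>G\<^esub> y"
    using assms(2) by (auto simp: edges_def)
  then have "x \<in> verts G" "y \<in> verts G" "x \<noteq> y"
    using adj_in_verts adj_not_same by auto
  then obtain w where "w \<in> verts G" "w \<noteq> v" by metis
  then have "(v, w) \<in> (arcs_ends G)\<^sup>*"
    using connected_imp_rtrancl assms by blast
  then show ?thesis
    using \<open>w \<noteq> v\<close> by (auto elim: converse_rtranclE)
qed

text \<open>If every vertex had exactly one neighbor, the two ends of any edge would form a set
  closed under adjacency. By connectedness this set would be all of \<open>verts G\<close>, leaving
  a single edge.\<close>

lemma (in graph) connected_two_neighbors_exist:
  assumes "Digraph_Component.connected G" "card (edges G) \<ge> 2"
  shows "\<exists>v \<in> verts G. card (neighborhood G v) \<noteq> 1"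
proof (rule ccontr)
  assume "\<not> ?thesis"
  then have one: "card (neighborhood G v) = 1" if "v \<in> verts G" for v
    using that by blast
  have unique: "w = w'" if w: "v \<rightarrow>\<^bsub>G\<^esub> w" "v \<rightarrow>\<^bsub>G\<^esub> w'" for v w w'
  proof -
    obtain z where z: "neighborhood G v = {z}"
      using one[OF adj_in_verts(1)[OF w(1)]] by (rule card_1_singletonE)
    have "w \<in> neighborhood G v" "w' \<in> neighborhood G v"
      using w by (simp_all add: neighborhood_def)
    then show ?thesis
      unfolding z by simp
  qed
  have "edges G \<noteq> {}" using assms(2) by auto
  then obtain x y where xy: "x \<rightarrow>\<^bsub>G\<^esub> y"
    by (auto simp: edges_def)
  have closed: "z = x \<or> z = y" if "(x, z) \<in> (arcs_ends G)\<^sup>*" for z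
    using that
  proof induction
    case (step z w)
    then show ?case using unique xy adj_sym by blast
  qed simp
  have verts: "z = x \<or> z = y" if "z \<in> verts G" for z
    using closed connected_imp_rtrancl[OF assms(1) _ that] xy adj_in_verts by blast
  have "edges G \<subseteq> {{x, y}}"
  proof
    fix e assume "e \<in> edges G"
    then obtain u v where e: "e = {u, v}" and uv: "u \<rightarrow>\<^bsub>G\<^esub> v"
      by (auto simp: edges_def)
    have "u \<in> verts G" "v \<in> verts G" "u \<noteq> v"
      using uv adj_in_verts adj_not_same by auto
    then have "{u, v} = {x, y}"
      using verts by blast
    then show "e \<in> {{x, y}}" using e by simp
  qed
  then have "card (edges G) \<le> card {{x, y}}"
    by (intro card_mono) auto
  then show False using assms(2) by simp
qed

text \<open>If all vertices share a color, a color occurring exactly once in a neighborhood forces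
  that neighborhood to be a singleton. This fails at the vertex \<open>v\<close> chosen
  below.\<close>

lemma cf_on_coloring_two_colors:
  assumes "graph G" "Digraph_Component.connected G" "card (edges G) \<ge> 2"
    and "cf_on_coloring G C"
  shows "2 \<le> card (C ` verts G)"
proof (rule ccontr)
  assume few: "\<not> ?thesis"
  interpret graph G by fact
  obtain v where v: "v \<in> verts G" "card (neighborhood G v) \<noteq> 1"
    using connected_two_neighbors_exist assms(2,3) by blast
  have "card (C ` verts G) \<le> Suc 0" using few by linarith
  then have same: "C x = C y" if "x \<in> verts G" "y \<in> verts G" for x y
    using that card_le_Suc0_iff_eq[of "C ` verts G"] finite_verts by blast
  obtain c where c: "card {u \<in> neighborhood G v. C u = c} = 1"
    using assms(4) v(1) by (auto simp: cf_on_coloring_def has_unique_color_def)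
  then obtain z where z: "{u \<in> neighborhood G v. C u = c} = {z}"
    by (rule card_1_singletonE)
  have nbrs: "u \<in> verts G" if "u \<in> neighborhood G v" for u
    using that adj_in_verts(2) by (auto simp: neighborhood_def)
  have "z \<in> neighborhood G v" "C z = c" using z by auto
  then have "C u = c" if "u \<in> neighborhood G v" for u
    using same[OF nbrs nbrs] that by metis
  then have "{u \<in> neighborhood G v. C u = c} = neighborhood G v"
    by blast
  then show False using c v(2) by simp
qed

section \<open>Shortest paths\<close>

text \<open>Take a walk of least length \<open>n\<close>. A walk of \<open>m\<close> steps from
  \<open>f i\<close> to \<open>f j\<close> can be spliced between the first \<open>i\<close> and the
  last \<open>n - j\<close> steps, so minimality gives
  \<open>n \<le> i + m + (n - j)\<close>.\<close>

lemma geodesic_exists: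
  assumes "(a, b) \<in> R\<^sup>*"
  obtains f n where "f 0 = a" "f n = b" "\<forall>i<n. (f i, f (Suc i)) \<in> R"
    and "\<forall>i\<le>n. \<forall>j\<le>n. \<forall>m. (f i, f j) \<in> R ^^ m \<longrightarrow> j \<le> i + m"
proof -
  define n where "n = (LEAST n. (a, b) \<in> R ^^ n)"
  have "(a, b) \<in> R ^^ n"
    unfolding n_def using rtrancl_imp_relpow[OF assms] by (rule LeastI_ex)
  then obtain f where f: "f 0 = a" "f n = b" "\<And>i. i < n \<Longrightarrow> (f i, f (Suc i)) \<in> R"
    by (auto simp: relpow_fun_conv)
  have "j \<le> i + m" if "i \<le> n" "j \<le> n" "(f i, f j) \<in> R ^^ m" for i j m
  proof -
    have "(a, f i) \<in> R ^^ i"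
      unfolding relpow_fun_conv using f that by (intro exI[of _ f]) auto
    moreover have "(f j, b) \<in> R ^^ (n - j)"
      unfolding relpow_fun_conv using f that by (intro exI[of _ "\<lambda>k. f (j + k)"]) auto
    ultimately have "(a, b) \<in> R ^^ (i + m + (n - j))"
      unfolding relpow_add using that(3) by blast
    then have "n \<le> i + m + (n - j)"
      unfolding n_def by (rule Least_le)
    then show ?thesis using that by linarith
  qed
  with f show ?thesis using that by blast
qed

lemma mod_3_eq_imp_eq:
  fixes i j :: nat
  assumes "j \<le> i + 2" "i \<le> j + 2" "j mod 3 = i mod 3"
  shows "j = i"
  using assms
proof (induction j i rule: linorder_wlog)
  case (le a b)
  then have "3 dvd b - a" "b - a < 3"
    by (auto simp: mod_eq_dvd_iff_nat[of a b, symmetric] dest: sym)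
  then show ?case using le by (auto dest: dvd_imp_le)
qed simp

text \<open>
  The color is well defined by the choice of the position \<open>i\<close> of a vertex on the path, which is
  unique by the case \<open>m = 0\<close>; the case \<open>m = 2\<close> bounds the positions of the neighbors of a vertex.
\<close>

lemma cf_on_coloring_of_dominating_geodesic:
  assumes "graph G"
    and geodesic: "\<And>i j m. i \<le> n \<Longrightarrow> j \<le> n \<Longrightarrow> (f i, f j) \<in> arcs_ends G ^^ m \<Longrightarrow> j \<le> i + m"
    and dominating: "\<And>v. v \<in> verts G \<Longrightarrow> \<exists>i\<le>n. v \<rightarrow>\<^bsub>G\<^esub> f i"
  shows "\<exists>C :: 'a \<Rightarrow> nat. cf_on_coloring G C \<and> C ` verts G \<subseteq> {..<4}"
proof -
  interpret graph G by fact
  have "inj_on f {..n}"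
  proof (rule inj_onI)
    fix i j assume "i \<in> {..n}" "j \<in> {..n}" "f i = f j"
    then show "i = j"
      using geodesic[of i j 0] geodesic[of j i 0] by simp
  qed
  define C where
    "C v = (if v \<in> f ` {..n} then the_inv_into {..n} f v mod 3 else 3)" for v
  have C_f: "C (f i) = i mod 3" if "i \<le> n" for i
    using that by (simp add: C_def the_inv_into_f_f[OF \<open>inj_on f {..n}\<close>])
  have C_other: "C v = 3" if "v \<notin> f ` {..n}" for v
    using that by (simp add: C_def)
  have "has_unique_color C (neighborhood G v)" if v: "v \<in> verts G" for v
  proof -
    obtain i where i: "i \<le> n" "v \<rightarrow>\<^bsub>G\<^esub> f i"
      using dominating v by blast
    have near: "j \<le> k + 2" if "j \<le> n" "k \<le> n" "v \<rightarrow>\<^bsub>G\<^esub> f j" "v \<rightarrow>\<^bsub>G\<^esub> f k" for j k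
    proof -
      have "(f k, f j) \<in> arcs_ends G ^^ 2"
        using adj_sym[OF that(4)] that(3) by (auto simp: numeral_2_eq_2)
      then show ?thesis using geodesic that by blast
    qed
    have unique: "u = f i" if u: "u \<in> neighborhood G v" "C u = i mod 3" for u
    proof -
      \<comment> \<open>Color 3 marks exactly the vertices off the path, so \<open>u\<close> must
        lie on it.\<close>
      have "C u \<noteq> 3" using u(2) mod_less_divisor[of 3 i] by linarith
      then obtain j where j: "j \<le> n" "u = f j"
        using C_other by blast
      then have "v \<rightarrow>\<^bsub>G\<^esub> f j" using u(1) by (simp add: neighborhood_def)
      then have "j \<le> i + 2" "i \<le> j + 2"
        using near i j by blast+
      moreover have "j mod 3 = i mod 3" using u j C_f by simp
      ultimately have "j = i" by (rule mod_3_eq_imp_eq)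
      then show ?thesis using j by simp
    qed
    have "f i \<in> neighborhood G v" "C (f i) = i mod 3"
      using i C_f by (simp_all add: neighborhood_def)
    then have "{u \<in> neighborhood G v. C u = i mod 3} = {f i}"
      by (auto intro: unique)
    then show ?thesis
      unfolding has_unique_color_def by (intro exI[of _ "i mod 3"]) simp
  qed
  moreover have "C v < 4" for v
    by (simp add: C_def less_trans[of _ 3])
  ultimately show ?thesis
    unfolding cf_on_coloring_def by blast
qed

section \<open>Interval graphs\<close>

text \<open>The relation holds vacuously when either set is empty, so it behaves as a strict order
  only on nonempty sets.\<close>

definition precedes :: "real set \<Rightarrow> real set \<Rightarrow> bool" where
  "precedes S T \<longleftrightarrow> (\<forall>x\<in>S. \<forall>y\<in>T. x < y)"

lemma precedes_trans:
  assumes "precedes S T" "precedes T U" "T \<noteq> {}"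
  shows "precedes S U"
  using assms unfolding precedes_def by (meson equals0I less_trans)

lemma precedes_asym:
  assumes "precedes S T" "precedes T S" "S \<noteq> {}"
  shows "T = {}"
  using assms unfolding precedes_def by (meson equals0I less_asym)

text \<open>If neither order holds, there are \<open>y \<le> x\<close> and
  \<open>x' \<le> y'\<close> with \<open>x\<close>, \<open>x'\<close> in \<open>S\<close> and
  \<open>y\<close>, \<open>y'\<close> in \<open>T\<close>. Either \<open>y\<close> lies between
  \<open>x'\<close> and \<open>x\<close>, hence in \<open>S\<close>, or \<open>x'\<close> lies
  between \<open>y\<close> and \<open>y'\<close>, hence in \<open>T\<close>.\<close>

lemma disjoint_intervals_precedes:
  assumes "is_interval S" "is_interval T" "S \<inter> T = {}"
  shows "precedes S T \<or> precedes T S"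
proof (rule ccontr)
  assume "\<not> ?thesis"
  then obtain x y x' y' where xy: "x \<in> S" "y \<in> T" "y \<le> x" "x' \<in> S" "y' \<in> T" "x' \<le> y'"
    unfolding precedes_def by (meson not_less)
  show False
  proof (cases "x' \<le> y")
    case True
    then have "y \<in> S" using assms(1) xy unfolding is_interval_1 by blast
    then show False using assms(3) xy by blast
  next
    case False
    then have "x' \<in> T" using assms(2) xy unfolding is_interval_1 by (meson linear)
    then show False using assms(3) xy by blast
  qed
qed

lemma interval_graph_coloring:
  assumes "graph G" "Digraph_Component.connected G" "interval_graph G" "edges G \<noteq> {}"
  shows "\<exists>C :: 'a \<Rightarrow> nat. cf_on_coloring G C \<and> C ` verts G \<subseteq> {..<4}"
proof -
  interpret graph G by fact
  obtain I :: "'a \<Rightarrow> real set" where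
    "\<forall>v\<in>verts G. is_interval (I v)" and
    "\<forall>u\<in>verts G. \<forall>v\<in>verts G. u \<noteq> v \<longrightarrow> (I u \<inter> I v \<noteq> {} \<longleftrightarrow> u \<rightarrow>\<^bsub>G\<^esub> v)"
    using assms(3) unfolding interval_graph_def by (elim exE conjE)
  then have interval: "\<And>v. v \<in> verts G \<Longrightarrow> is_interval (I v)" and
    adj: "\<And>u v. \<lbrakk>u \<in> verts G; v \<in> verts G; u \<noteq> v\<rbrakk> \<Longrightarrow> I u \<inter> I v \<noteq> {} \<longleftrightarrow> u \<rightarrow>\<^bsub>G\<^esub> v"
    by simp_all
  have nbr: "\<exists>w. v \<rightarrow>\<^bsub>G\<^esub> w" if "v \<in> verts G" for v
    using connected_neighbor_exists assms that by blast
  have ne: "I v \<noteq> {}" if "v \<in> verts G" for v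
    using nbr[OF that] adj that adj_in_verts adj_not_same by (metis inf_bot_left)
  define before where "before u v \<longleftrightarrow> precedes (I u) (I v)" for u v
  have asym: "\<not> before v u" if "before u v" "u \<in> verts G" "v \<in> verts G" for u v
    using precedes_asym[of "I u" "I v"] ne[OF that(2)] ne[OF that(3)] that(1)
    unfolding before_def by blast
  have trans: "before u w" if "before u v" "before v w" "v \<in> verts G" for u v w
    using precedes_trans[OF _ _ ne[OF that(3)]] that(1,2) unfolding before_def by blast
  have total: "before u v \<or> before v u"
    if "u \<in> verts G" "v \<in> verts G" "u \<noteq> v" "\<not> u \<rightarrow>\<^bsub>G\<^esub> v" for u v
    using disjoint_intervals_precedes[OF interval[OF that(1)] interval[OF that(2)]] adj[OF that(1-3)]
      that(4) unfolding before_def by blast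
  have not_before: "\<not> before u v" if uv: "u \<rightarrow>\<^bsub>G\<^esub> v" for u v
  proof -
    have "u \<in> verts G" "v \<in> verts G" "u \<noteq> v"
      using uv adj_in_verts adj_not_same by auto
    then obtain x where "x \<in> I u" "x \<in> I v"
      using adj[of u v] uv by blast
    then show ?thesis
      unfolding before_def precedes_def by blast
  qed
  have "verts G \<noteq> {}"
    using assms(4) adj_in_verts by (fastforce simp: edges_def)
  have asymp: "asymp_on (verts G) before"
    by (rule asymp_onI) (rule asym)
  have transp: "transp_on (verts G) before"
    by (rule transp_onI) (rule trans)
  have irrefl: "\<not> before v v" if "v \<in> verts G" for v
    using asym[of v v] that by blast
  obtain a where "a \<in> verts G" "\<forall>v\<in>verts G. v \<noteq> a \<longrightarrow> \<not> before v a"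
    using Finite_Set.bex_min_element[OF finite_verts asymp transp \<open>verts G \<noteq> {}\<close>] by blast
  then have a: "a \<in> verts G" "\<And>v. v \<in> verts G \<Longrightarrow> \<not> before v a"
    using irrefl by metis+
  \<comment> \<open>What matters is that no vertex lies to the right of both \<open>a\<close> and
    \<open>b\<close>. A maximal \<open>b\<close> works if something lies to the right of
    \<open>a\<close>; otherwise the condition is vacuous. Requiring \<open>b \<noteq> a\<close>
    gives the path at least one edge.\<close>
  obtain b where b: "b \<in> verts G" "b \<noteq> a" "\<And>v. \<lbrakk>v \<in> verts G; before a v\<rbrakk> \<Longrightarrow> \<not> before b v"
  proof (cases "\<exists>v\<in>verts G. before a v")
    case True
    obtain b where "b \<in> verts G" "\<forall>v\<in>verts G. v \<noteq> b \<longrightarrow> \<not> before b v"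
      using Finite_Set.bex_max_element[OF finite_verts asymp transp \<open>verts G \<noteq> {}\<close>] by blast
    then have b: "b \<in> verts G" "\<And>v. v \<in> verts G \<Longrightarrow> \<not> before b v"
      using irrefl by metis+
    moreover have "b \<noteq> a" using True b(2) by blast
    ultimately show ?thesis using that[of b] by blast
  next
    case False
    obtain w where "a \<rightarrow>\<^bsub>G\<^esub> w" using nbr a(1) by blast
    then have "w \<in> verts G" "w \<noteq> a" using adj_in_verts adj_not_same by auto
    then show ?thesis using that[of w] False by blast
  qed
  obtain f n where path: "f 0 = a" "f n = b" "\<forall>i<n. f i \<rightarrow>\<^bsub>G\<^esub> f (Suc i)"
    "\<forall>i\<le>n. \<forall>j\<le>n. \<forall>m. (f i, f j) \<in> arcs_ends G ^^ m \<longrightarrow> j \<le> i + m"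
    by (rule geodesic_exists[OF connected_imp_rtrancl[OF assms(2) a(1) b(1)]])
  then have f: "f 0 = a" "f n = b" "\<And>i. i < n \<Longrightarrow> f i \<rightarrow>\<^bsub>G\<^esub> f (Suc i)"
    and geodesic: "\<And>i j m. i \<le> n \<Longrightarrow> j \<le> n \<Longrightarrow> (f i, f j) \<in> arcs_ends G ^^ m \<Longrightarrow> j \<le> i + m"
    by simp_all
  have "n \<noteq> 0" using f(1,2) b(2) by (intro notI) simp
  have f_verts: "f i \<in> verts G" if "i \<le> n" for i
    using that b(1) f(2) adj_in_verts(1)[OF f(3)[of i]] by (cases "i = n") auto
  have "\<exists>i\<le>n. v \<rightarrow>\<^bsub>G\<^esub> f i" if v: "v \<in> verts G" for v
  proof (cases "v \<in> f ` {..n}")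
    case True
    then obtain i where i: "i \<le> n" "v = f i" by auto
    show ?thesis
    \<comment> \<open>A path vertex is adjacent to its successor, and the last one to its
      predecessor, which exists since \<open>n \<noteq> 0\<close>.\<close>
    proof (cases "i = n")
      case True
      then show ?thesis
        using f(3)[of "n - 1"] \<open>n \<noteq> 0\<close> i adj_sym by (intro exI[of _ "n - 1"]) simp
    next
      case False
      then show ?thesis using f(3) i by (intro exI[of _ "Suc i"]) auto
    qed
  next
    case off_path: False
    show ?thesis
    proof (rule ccontr)
      assume "\<not> ?thesis"
      then have side: "before (f i) v \<or> before v (f i)" if "i \<le> n" for i
        using total[OF f_verts[OF that] v] that off_path adj_sym by blast
      \<comment> \<open>The path cannot jump over \<open>v\<close>: if \<open>f i\<close> lay to its
        left and \<open>f (Suc i)\<close> to its right, transitivity would put \<open>f i\<close>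
        before its neighbor \<open>f (Suc i)\<close>. Minimality of \<open>a\<close> starts the
        induction.\<close>
      have left: "before (f i) v" if "i \<le> n" for i
        using that
      proof (induction i)
        case 0
        then show ?case using side[of 0] a(2)[OF v] f(1) by simp
      next
        case (Suc i)
        then show ?case
          using side[of "Suc i"] trans[OF _ _ v, of "f i" "f (Suc i)"] not_before[OF f(3)[of i]]
          by auto
      qed
      \<comment> \<open>Positions \<open>0\<close> and \<open>n\<close> place \<open>v\<close> to
        the right of both \<open>a\<close> and \<open>b\<close>, against the choice of
        \<open>b\<close>.\<close>
      show False
        using left[of 0] left[of n] b(3)[OF v] f by simp
    qed
  qed
  then show ?thesis
    using cf_on_coloring_of_dominating_geodesic[OF assms(1) geodesic] by blast
qed

theorem theorem6:
  fixes G :: "('a, 'b) pre_digraph"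
  assumes "graph G"
    and "Digraph_Component.connected G"
    and "interval_graph G"
    and "card (edges G) \<ge> 2"
  shows "2 \<le> chi_cf G \<and> chi_cf G \<le> 4"
proof
  show "2 \<le> chi_cf G"
    unfolding chi_cf_def
  proof (rule Inf_greatest)
    fix k assume "k \<in> {enat (card (C ` verts G)) | C :: 'a \<Rightarrow> nat. cf_on_coloring G C}"
    then obtain C :: "'a \<Rightarrow> nat" where "k = enat (card (C ` verts G))" "cf_on_coloring G C"
      by blast
    then show "2 \<le> k"
      using cf_on_coloring_two_colors[OF assms(1,2,4)] by (simp add: numeral_eq_enat)
  qed
next
  have "edges G \<noteq> {}" using assms(4) by auto
  then obtain C :: "'a \<Rightarrow> nat" where C: "cf_on_coloring G C" "C ` verts G \<subseteq> {..<4}"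
    using interval_graph_coloring assms by blast
  have "card (C ` verts G) \<le> 4"
    using card_mono[OF _ C(2)] by simp
  then have "enat (card (C ` verts G)) \<le> 4"
    by (simp add: numeral_eq_enat)
  moreover have "chi_cf G \<le> enat (card (C ` verts G))"
    unfolding chi_cf_def using C(1) by (intro Inf_lower) blast
  ultimately show "chi_cf G \<le> 4" by simp
qed

end
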